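(* Let $1<p<\infty$, let $\varepsilon>0$, let $\Omega\subset\mathbb{R}^N$ be a bounded domain, and let $f:\Omega\to\mathbb{R}$ and $g:\Gamma_\varepsilon\to\mathbb{R}$ be bounded Borel measurable functions, where $\Gamma_\varepsilon=\Omega_\varepsilon\setminus\Omega$. Then there exists a bounded Borel measurable function $u:\Omega_\varepsilon\to\mathbb{R}$ such that $$u(x)=\frac12\Big(\sup_{|z|=1}\mathcal{I}^z_\varepsilon u(x)+\inf_{|z|=1}\mathcal{I}^z_\varepsilon u(x)\Big)+\varepsilon^2 f(x)\quad\text{for all }x\in\Omega,$$ and $u(x)=g(x)$ for all $x\in\Gamma_\varepsilon$.
   Context: $N\ge 1$ is an integer, $B_1$ is the open unit ball of $\mathbb{R}^N$ centered at the origin, $|B_1|$ its Lebesgue measure. For $\varepsilon>0$, $\Omega_\varepsilon=\{x\in\mathbb{R}^N:\operatorname{dist}(x,\Omega)<\varepsilon\}$. Write $(t)_+^{p-2}=t^{p-2}$ if $t>0$ and $(t)_+^{p-2}=0$ if $t\le 0$. Let $\gamma_{N,p}=\frac{1}{|B_1|}\int_{B_1}(z\cdot h)_+^{p-2}\,dh$, which is finite and independent of the unit vector $z$. For a bounded Borel measurable function $u:\Omega_\varepsilon\to\mathbb{R}$, $x\in\overline\Omega$ and $z\in\mathbb{R}^N$ with $|z|=1$, $$\mathcal{I}^z_\varepsilon u(x)=\frac{1}{\gamma_{N,p}}\cdot\frac{1}{|B_1|}\int_{B_1}u(x+\varepsilon h)\,(z\cdot h)_+^{p-2}\,dh .$$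 Suprema and infima over $|z|=1$ are over all unit vectors $z\in\mathbb{R}^N$. *)

theory Defs
  imports "HOL-Analysis.Analysis"
begin

definition nbhd :: "real \<Rightarrow> (real ^ 'n) set \<Rightarrow> (real ^ 'n) set" where
  "nbhd \<epsilon> \<Omega> = {x. infdist x \<Omega> < \<epsilon>}"

definition Gam :: "real \<Rightarrow> (real ^ 'n) set \<Rightarrow> (real ^ 'n) set" where
  "Gam \<epsilon> \<Omega> = nbhd \<epsilon> \<Omega> - \<Omega>"

text \<open>A function on \<open>S\<close> is represented by a total function; only its values on \<open>S\<close> are
  constrained.\<close>

definition bounded_borel_on :: "(real ^ 'n) set \<Rightarrow> (real ^ 'n \<Rightarrow> real) \<Rightarrow> bool" where
  "bounded_borel_on S u \<longleftrightarrow> u \<in> borel_measurable (restrict_space borel S) \<and> bounded (u ` S)"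

definition pos_powr :: "real \<Rightarrow> real \<Rightarrow> real" where
  "pos_powr t a = (if t > 0 then t powr a else 0)"

definition ball_avg :: "(real ^ 'n \<Rightarrow> real) \<Rightarrow> real" where
  "ball_avg F = 1 / measure lborel (ball (0 :: real ^ 'n) 1) *
     (LINT h:ball 0 1|lborel. F h)"

text \<open>The constant \<open>\<gamma>\<close> with exponent \<open>p\<close> in the dimension of the vector \<open>z\<close>. For unit vectors
  it does not depend on \<open>z\<close>: see \<open>gam_unit_indep\<close> below.\<close>

definition gam :: "real \<Rightarrow> real ^ 'n \<Rightarrow> real" where
  "gam p z = ball_avg (\<lambda>h. pos_powr (z \<bullet> h) (p - 2))"

text \<open>For \<open>x\<close> in the closure of \<open>\<Omega>\<close> the points \<open>x + \<epsilon> h\<close> with \<open>h\<close> in the open unit ball all lie in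
  \<open>nbhd \<epsilon> \<Omega>\<close>, so the values of \<open>u\<close> outside that set are irrelevant.\<close>

definition Iop :: "real \<Rightarrow> real \<Rightarrow> real ^ 'n \<Rightarrow> (real ^ 'n \<Rightarrow> real) \<Rightarrow> real ^ 'n \<Rightarrow> real" where
  "Iop p \<epsilon> z u x =
     1 / gam p z * ball_avg (\<lambda>h. u (x + \<epsilon> *\<^sub>R h) * pos_powr (z \<bullet> h) (p - 2))"

lemma lborel_distr_orthogonal:
  fixes f :: "real ^ 'n \<Rightarrow> real ^ 'n"
  assumes f: "orthogonal_transformation f"
  shows "distr lborel borel f = lborel"
proof (rule measure_eqI)
  define M where "M = distr lborel borel f"
  have lin: "linear f" using f by (rule orthogonal_transformation_linear)
  have [measurable]: "f \<in> borel_measurable borel"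
    using lin by (intro borel_measurable_continuous_onI linear_continuous_on)
      (simp add: linear_conv_bounded_linear)
  have sM [measurable_cong]: "sets M = sets borel" and spM: "space M = UNIV"
    by (simp_all add: M_def)
  define B where "B = (ball 0 1 :: (real ^ 'n) set)"
  have B [measurable]: "B \<in> sets borel" by (simp add: B_def)
  have preB: "f -` ball 0 r = ball 0 r" for r
    using f by (auto simp: orthogonal_transformation_norm)
  have MB: "emeasure M B = emeasure lborel B"
    unfolding M_def B_def by (subst emeasure_distr) (simp_all add: preB)
  have B0: "emeasure lborel B \<noteq> 0" "emeasure lborel B \<noteq> \<infinity>"
    using emeasure_lborel_ball_finite[of "0 :: real ^ 'n" 1]
    by (auto simp: B_def emeasure_eq_measure2 content_ball_pos zero_less_measure_iff
        dest: order.strict_implies_not_eq)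
      (metis content_ball_pos measure_def enn2real_0 less_irrefl zero_less_one)
  have sf: "sigma_finite_measure M"
  proof
    show "\<exists>A. countable A \<and> A \<subseteq> sets M \<and> \<Union> A = space M \<and> (\<forall>a\<in>A. emeasure M a \<noteq> \<infinity>)"
    proof (intro exI[of _ "range (\<lambda>n. ball 0 (real n))"] conjI ballI)
      show "\<Union> (range (\<lambda>n. ball 0 (real n))) = space M"
        by (auto simp: spM intro: reals_Archimedean2)
      fix a assume "a \<in> range (\<lambda>n. ball (0 :: real ^ 'n) (real n))"
      then obtain n where a: "a = ball 0 (real n)" by auto
      have "emeasure M a = emeasure lborel (ball (0 :: real ^ 'n) (real n))"
        unfolding a M_def by (subst emeasure_distr) (simp_all add: preB)
      then show "emeasure M a \<noteq> \<infinity>"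
        using emeasure_lborel_ball_finite[of "0 :: real ^ 'n" "real n"] by simp
    qed (auto simp: sM)
  qed
  interpret MM: sigma_finite_measure M by (rule sf)
  interpret LM: pair_sigma_finite lborel M ..
  have trans: "(\<integral>\<^sup>+x. g (x + c) \<partial>M) = (\<integral>\<^sup>+x. g x \<partial>M)"
    if [measurable]: "g \<in> borel_measurable borel" for g :: "real ^ 'n \<Rightarrow> ennreal" and c
  proof -
    obtain d where d: "f d = c"
      using orthogonal_transformation_surj[OF f] by (metis surjD)
    have "(\<integral>\<^sup>+x. g (x + c) \<partial>M) = (\<integral>\<^sup>+x. g (f (d + x)) \<partial>lborel)"
      unfolding M_def
      by (subst nn_integral_distr) (simp_all add: linear_add[OF lin] d add.commute)
    also have "\<dots> = (\<integral>\<^sup>+x. g (f x) \<partial>distr lborel borel ((+) d))"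
      by (subst nn_integral_distr) simp_all
    also have "\<dots> = (\<integral>\<^sup>+x. g (f x) \<partial>lborel)"
      by (simp add: lborel_distr_plus)
    also have "\<dots> = (\<integral>\<^sup>+x. g x \<partial>M)"
      unfolding M_def by (subst nn_integral_distr) simp_all
    finally show ?thesis .
  qed
  have ltrans: "(\<integral>\<^sup>+y. g (c + y) \<partial>lborel) = (\<integral>\<^sup>+y. g y \<partial>lborel)"
    if [measurable]: "g \<in> borel_measurable borel" for g :: "real ^ 'n \<Rightarrow> ennreal" and c
  proof -
    have "(\<integral>\<^sup>+y. g (c + y) \<partial>lborel) = (\<integral>\<^sup>+y. g y \<partial>distr lborel borel ((+) c))"
      by (subst nn_integral_distr) simp_all
    then show ?thesis by (simp add: lborel_distr_plus)
  qed
  have refl_distr: "distr lborel borel uminus = (lborel :: (real ^ 'n) measure)"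
    using lborel_affine[of "-1" "0 :: real ^ 'n"] by (simp add: density_1)
  have lrefl: "(\<integral>\<^sup>+y. g (- y) \<partial>lborel) = (\<integral>\<^sup>+y. g y \<partial>lborel)"
    if [measurable]: "g \<in> borel_measurable borel" for g :: "real ^ 'n \<Rightarrow> ennreal"
  proof -
    have "(\<integral>\<^sup>+y. g (- y) \<partial>lborel) = (\<integral>\<^sup>+y. g y \<partial>distr lborel borel uminus)"
      by (subst nn_integral_distr) simp_all
    then show ?thesis by (simp add: refl_distr)
  qed
  fix A assume "A \<in> sets (distr lborel borel f)"
  then have A [measurable]: "A \<in> sets borel" by simp
  have "emeasure M A * emeasure lborel B =
      (\<integral>\<^sup>+x. (\<integral>\<^sup>+y. indicator A x * indicator B (x + y) \<partial>lborel) \<partial>M)"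
    by (simp add: nn_integral_cmult ltrans nn_integral_multc sM)
  also have "\<dots> = (\<integral>\<^sup>+y. (\<integral>\<^sup>+x. indicator A x * indicator B (x + y) \<partial>M) \<partial>lborel)"
    by (rule LM.Fubini') measurable
  also have "\<dots> = (\<integral>\<^sup>+y. (\<integral>\<^sup>+x. indicator A (x - y) * indicator B x \<partial>M) \<partial>lborel)"
    using trans[of "\<lambda>x. indicator A (x - y) * indicator B x" y for y] by simp
  also have "\<dots> = (\<integral>\<^sup>+x. (\<integral>\<^sup>+y. indicator A (x - y) * indicator B x \<partial>lborel) \<partial>M)"
    by (rule LM.Fubini'[symmetric]) measurable
  also have "\<dots> = (\<integral>\<^sup>+x. (\<integral>\<^sup>+y. indicator A (x + y) \<partial>lborel) * indicator B x \<partial>M)"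
    using lrefl[of "\<lambda>y. indicator A (x + y)" for x]
    by (simp add: nn_integral_multc)
  also have "\<dots> = emeasure lborel A * emeasure M B"
    by (simp add: nn_integral_cmult ltrans sM)
  finally have "emeasure M A * emeasure lborel B = emeasure lborel A * emeasure lborel B"
    by (simp add: MB)
  then have "emeasure M A = emeasure lborel A"
    using B0 by (metis ennreal_mult_divide_eq infinity_ennreal_def)
  then show "emeasure (distr lborel borel f) A = emeasure lborel A"
    by (simp add: M_def)
qed simp

lemma gam_unit_indep:
  fixes z w :: "real ^ 'n"
  assumes "norm z = 1" "norm w = 1"
  shows "gam p z = gam p w"
proof -
  obtain f where f: "orthogonal_transformation f" and fz: "f z = w"
    using orthogonal_transformation_exists[of z w] assms by auto
  have [measurable]: "f \<in> borel_measurable borel"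
    using orthogonal_transformation_linear[OF f]
    by (intro borel_measurable_continuous_onI linear_continuous_on)
      (simp add: linear_conv_bounded_linear)
  have 1: "(\<lambda>t. pos_powr t (p - 2)) \<in> borel_measurable borel"
    unfolding pos_powr_def by measurable
  have 2: "(\<lambda>h. indicat_real (ball 0 1) h *\<^sub>R pos_powr (w \<bullet> h) (p - 2)) \<in> borel_measurable borel"
    by (intro borel_measurable_scaleR borel_measurable_indicator
        measurable_compose[OF _ 1]) simp_all
  have "(LINT h:ball 0 1|lborel. pos_powr (w \<bullet> h) (p - 2)) =
      (LINT h:ball 0 1|distr lborel borel f. pos_powr (w \<bullet> h) (p - 2))"
    by (simp add: lborel_distr_orthogonal[OF f])
  also have "\<dots> = (LINT h|lborel. indicator (ball 0 1) (f h) *\<^sub>R pos_powr (w \<bullet> f h) (p - 2))"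
    unfolding set_lebesgue_integral_def
    by (rule integral_distr[OF _ 2]) simp
  also have "\<dots> = (LINT h:ball 0 1|lborel. pos_powr (z \<bullet> h) (p - 2))"
    using f unfolding set_lebesgue_integral_def
    by (auto simp: orthogonal_transformation_norm orthogonal_transformation_def
        indicator_def simp flip: fz intro!: Bochner_Integration.integral_cong)
  finally show ?thesis
    by (simp add: gam_def ball_avg_def)
qed

end

theory Submission
  imports Defs
begin

text \<open>Monotone iteration \<open>u (k + 1) = T (u k)\<close> of the tug-of-war operator \<open>T\<close>, started at the subsolution
  \<open>- q\<close> and bounded above by the supersolution \<open>q\<close>, where \<open>q\<close> is a concave paraboloid on
  \<open>nbhd \<epsilon> \<Omega>\<close>. The pointwise limit is a fixed point, because the supremum and the infimum over the
  directions pass to the limit: if \<open>z k\<close> converges to \<open>z\<close> and the uniformly bounded \<open>u k\<close> converge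
  pointwise to \<open>v\<close>, then the directed averages of \<open>u k\<close> along \<open>z k\<close> converge to that of \<open>v\<close> along
  \<open>z\<close>, so on the compact unit sphere the convergence is uniform. The same continuity in the
  direction reduces the supremum to a countable dense set of directions, which gives
  measurability.\<close>

section \<open>Invariance of Lebesgue integrals under orthogonal maps\<close>

lemma borel_measurable_orthogonal_transformation:
  fixes f :: "'a::euclidean_space \<Rightarrow> 'a"
  assumes "orthogonal_transformation f"
  shows "f \<in> borel_measurable borel"
  using orthogonal_transformation_linear[OF assms]
  by (intro borel_measurable_continuous_onI linear_continuous_on)
    (simp add: linear_conv_bounded_linear)

lemma lborel_integral_orthogonal:
  fixes f :: "real ^ 'n \<Rightarrow> real ^ 'n" and F :: "real ^ 'n \<Rightarrow> real"
  assumes f: "orthogonal_transformation f" and F: "F \<in> borel_measurable borel"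
  shows "(\<integral>h. F (f h) \<partial>lborel) = (\<integral>h. F h \<partial>lborel)"
proof -
  have "(\<integral>h. F h \<partial>lborel) = (\<integral>h. F h \<partial>distr lborel borel f)"
    by (simp add: lborel_distr_orthogonal[OF f])
  also have "\<dots> = (\<integral>h. F (f h) \<partial>lborel)"
    using borel_measurable_orthogonal_transformation[OF f] by (intro integral_distr) (simp_all add: F)
  finally show ?thesis ..
qed

lemma lborel_integrable_orthogonal:
  fixes f :: "real ^ 'n \<Rightarrow> real ^ 'n" and F :: "real ^ 'n \<Rightarrow> real"
  assumes f: "orthogonal_transformation f" and F: "integrable lborel F"
  shows "integrable lborel (\<lambda>h. F (f h))"
proof -
  have "integrable (distr lborel borel f) F"
    using F by (simp add: lborel_distr_orthogonal[OF f])
  then show ?thesis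
    using borel_measurable_orthogonal_transformation[OF f] F
    by (subst (asm) integrable_distr_eq) simp_all
qed

section \<open>The directional weight: integrability and moments\<close>

text \<open>The indicator of the unit ball is built in, so that all averages become integrals over
  the whole space.\<close>

definition weight :: "real \<Rightarrow> real ^ 'n \<Rightarrow> real ^ 'n \<Rightarrow> real" where
  "weight p z h = indicator (ball 0 1) h * pos_powr (z \<bullet> h) (p - 2)"

lemma pos_powr_measurable [measurable]: "(\<lambda>t. pos_powr t a) \<in> borel_measurable borel"
  unfolding pos_powr_def by measurable

lemma pos_powr_nonneg [simp]: "0 \<le> pos_powr t a"
  by (simp add: pos_powr_def)

lemma weight_measurable [measurable]: "weight p z \<in> borel_measurable borel"
proof -
  have [measurable]: "(\<lambda>h. pos_powr (z \<bullet> h) (p - 2)) \<in> borel_measurable borel"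
    by (rule measurable_compose[OF _ pos_powr_measurable]) simp
  show ?thesis
    unfolding weight_def[abs_def] by (intro borel_measurable_times borel_measurable_indicator) simp_all
qed

lemma weight_nonneg [simp]: "0 \<le> weight p z h"
  by (simp add: weight_def)

lemma weight_eq_0: "norm h \<ge> 1 \<Longrightarrow> weight p z h = 0"
  by (simp add: weight_def)

text \<open>Orthogonal maps preserve inner products and norms. This reduces integrals for one
  direction to those for any other.\<close>

lemma weight_orthogonal:
  "orthogonal_transformation f \<Longrightarrow> weight p (f z) (f h) = weight p z h"
  by (simp add: weight_def indicator_def orthogonal_transformation_norm
      orthogonal_transformation_def[of f])

text \<open>Integrability of a power at the origin. It is applied with exponent
  \<open>p - 2\<close>, where the condition reads \<open>1 < p\<close>.\<close>

lemma nn_integral_pos_powr: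
  assumes "- 1 < a"
  shows "(\<integral>\<^sup>+t. indicator {0..1} t * pos_powr t a \<partial>lborel) < \<infinity>"
proof -
  have "((\<lambda>t::real. t powr a) has_integral 1 powr (a + 1) / (a + 1)) {0..1}"
    by (rule has_integral_powr_from_0) (use assms in auto)
  then have "integral\<^sup>N lborel (\<lambda>t. indicator {0..1} t * t powr a) = 1 powr (a + 1) / (a + 1)"
    by (intro nn_integral_has_integral_lebesgue) auto
  moreover have "(\<integral>\<^sup>+t. indicator {0..1} t * pos_powr t a \<partial>lborel) =
      integral\<^sup>N lborel (\<lambda>t. ennreal (indicator {0..1} t * t powr a))"
    by (intro nn_integral_cong) (auto simp: pos_powr_def indicator_def)
  ultimately show ?thesis by simp
qed

text \<open>After a rotation the direction is a basis vector \<open>b\<close>, and the power depends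
  on a single coordinate. The ball lies in the cube with sides [-1,1], over which the integral
  factors into one-dimensional ones.\<close>

lemma integrable_weight:
  fixes z :: "real ^ 'n"
  assumes p: "1 < p" and z: "norm z = 1"
  shows "integrable lborel (weight p z)"
proof -
  obtain b :: "real ^ 'n" where b: "b \<in> Basis"
    using nonempty_Basis by blast
  define F where "F c t = indicator {- 1..1} t * (if c = b then pos_powr t (p - 2) else 1)"
    for c :: "real ^ 'n" and t :: real
  have "integrable lborel (weight p b)"
  proof (rule integrableI_bounded)
    have "(\<integral>\<^sup>+h. norm (weight p b h) \<partial>lborel) \<le> (\<integral>\<^sup>+h. (\<Prod>c\<in>Basis. ennreal (F c (h \<bullet> c))) \<partial>lborel)"
    proof (intro nn_integral_mono)
      fix h :: "real ^ 'n"
      show "ennreal (norm (weight p b h)) \<le> (\<Prod>c\<in>Basis. ennreal (F c (h \<bullet> c)))"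
      proof (cases "norm h < 1")
        case True
        \<comment> \<open>In the unit ball every coordinate lies in [-1,1], so all indicators are 1
          and the product collapses to the factor of \<open>b\<close>.\<close>
        have "F c (h \<bullet> c) = (if c = b then pos_powr (h \<bullet> b) (p - 2) else 1)" if "c \<in> Basis" for c
          using Basis_le_norm[OF that, of h] True by (auto simp: F_def indicator_def)
        then have "(\<Prod>c\<in>Basis. ennreal (F c (h \<bullet> c))) =
            (\<Prod>c\<in>Basis. if c = b then ennreal (pos_powr (h \<bullet> b) (p - 2)) else 1)"
          by (intro prod.cong) auto
        also have "\<dots> = pos_powr (h \<bullet> b) (p - 2)"
          using b by (simp add: prod.delta)
        finally show ?thesis
          using True by (simp add: weight_def inner_commute)
      qed (simp add: weight_eq_0)
    qed
    also have "\<dots> = (\<Prod>c\<in>Basis. \<integral>\<^sup>+t. ennreal (F c t) \<partial>lborel)"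
      by (rule nn_integral_lborel_prod) (auto simp: F_def)
    also have "\<dots> < \<infinity>"
    proof -
      have *: "(\<integral>\<^sup>+t. ennreal (F c t) \<partial>lborel) < top" for c
      proof (cases "c = b")
        case True
        have "(\<integral>\<^sup>+t. ennreal (F c t) \<partial>lborel) =
            (\<integral>\<^sup>+t. ennreal (indicator {0..1} t * pos_powr t (p - 2)) \<partial>lborel)"
          by (intro nn_integral_cong) (auto simp: F_def True indicator_def pos_powr_def)
        then show ?thesis using nn_integral_pos_powr[of "p - 2"] p by simp
      next
        case False
        have "(\<integral>\<^sup>+t. ennreal (F c t) \<partial>lborel) = (\<integral>\<^sup>+t. indicator {- 1..1::real} t \<partial>lborel)"
          by (intro nn_integral_cong) (auto simp: F_def False indicator_def)
        then show ?thesis by simp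
      qed
      then show ?thesis
        by (induction rule: finite_induct[OF finite_Basis]) (simp_all add: ennreal_mult_less_top *)
    qed
    finally show "(\<integral>\<^sup>+h. norm (weight p b h) \<partial>lborel) < \<infinity>" .
  qed simp
  moreover obtain f where "orthogonal_transformation f" "f z = b"
    using orthogonal_transformation_exists[of z b] z b by auto
  ultimately show ?thesis
    using lborel_integrable_orthogonal[of f "weight p b"] weight_orthogonal[of f p z] by simp
qed

text \<open>For \<open>k = 0\<close> this is \<open>gam p z\<close> times the volume of the unit
  ball; \<open>k = 2\<close> measures how much averaging lowers a concave paraboloid.\<close>

definition moment :: "nat \<Rightarrow> real \<Rightarrow> real ^ 'n \<Rightarrow> real" where
  "moment k p z = (\<integral>h. norm h ^ k * weight p z h \<partial>lborel)"

lemma integrable_moment: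
  fixes z :: "real ^ 'n"
  assumes p: "1 < p" and z: "norm z = 1"
  shows "integrable lborel (\<lambda>h. norm h ^ k * weight p z h)"
proof (rule Bochner_Integration.integrable_bound[OF integrable_weight[OF assms]])
  have "norm h ^ k * weight p z h \<le> weight p z h" for h
    by (cases "norm h < 1") (auto simp: weight_eq_0 power_le_one intro: mult_left_le_one_le)
  then show "AE h in lborel. norm (norm h ^ k * weight p z h) \<le> norm (weight p z h)"
    by simp
qed simp

lemma moment_unit_indep:
  fixes z w :: "real ^ 'n"
  assumes "norm z = 1" "norm w = 1"
  shows "moment k p z = moment k p w"
proof -
  obtain f where f: "orthogonal_transformation f" "f z = w"
    using orthogonal_transformation_exists[of z w] assms by auto
  have "moment k p w = (\<integral>h. norm (f h) ^ k * weight p w (f h) \<partial>lborel)"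
    unfolding moment_def by (rule lborel_integral_orthogonal[OF f(1), symmetric]) simp
  also have "\<dots> = moment k p z"
    using f weight_orthogonal[OF f(1), of p z] by (simp add: moment_def orthogonal_transformation_norm)
  finally show ?thesis ..
qed

text \<open>The integrand is nonnegative and strictly positive on the open half ball where
  \<open>z \<bullet> h > 0\<close>. That set contains half of \<open>z\<close>, and a nonempty open
  set is not a null set.\<close>

lemma moment_pos:
  fixes z :: "real ^ 'n"
  assumes p: "1 < p" and z: "norm z = 1"
  shows "0 < moment k p z"
proof -
  have "moment k p z \<noteq> 0"
  proof
    assume "moment k p z = 0"
    then have "AE h in lborel. norm h ^ k * weight p z h = 0"
      unfolding moment_def
      by (subst (asm) integral_nonneg_eq_0_iff_AE[OF integrable_moment[OF assms]]) auto
    then have "AE h in lborel. h \<notin> ball 0 1 \<inter> {h. 0 < z \<bullet> h}"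
      by eventually_elim (auto simp: weight_def pos_powr_def)
    moreover have op: "open (ball 0 1 \<inter> {h. 0 < z \<bullet> h})"
      by (intro open_Int open_ball open_halfspace_gt)
    moreover have "ball 0 1 \<inter> {h. 0 < z \<bullet> h} \<noteq> {}"
    proof -
      have "(1/2) *\<^sub>R z \<in> ball 0 1 \<inter> {h. 0 < z \<bullet> h}"
        using z by (simp add: dot_square_norm)
      then show ?thesis by blast
    qed
    ultimately show False
      using AE_iff_null_sets[of "ball 0 1 \<inter> {h. 0 < z \<bullet> h}" lborel]
        open_not_negligible[OF op] negligible_iff_null_sets null_sets_completionI
      by (metis borel_open sets_lborel)
  qed
  moreover have "0 \<le> moment k p z"
    unfolding moment_def by (intro integral_nonneg_AE) auto
  ultimately show ?thesis by simp
qed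

lemma weight_0_moment: "(\<integral>h. weight p z h \<partial>lborel) = moment 0 p z"
  by (simp add: moment_def)

lemma LINT_ball_weight:
  "(LINT h:ball 0 1|lborel. u h * pos_powr (z \<bullet> h) (p - 2)) = (\<integral>h. weight p z h * u h \<partial>lborel)"
  unfolding set_lebesgue_integral_def weight_def
  by (intro Bochner_Integration.integral_cong) auto

section \<open>Directed averages: order, bounds, measurability and convergence\<close>

text \<open>The volume of the ball cancels between the average and its normalising constant. If the
  moment is 0, both sides are 0 by the convention for division, so the identity holds for every
  \<open>z\<close>.\<close>

lemma Iop_eq:
  fixes z :: "real ^ 'n"
  shows "Iop p \<epsilon> z u x = (\<integral>h. weight p z h * u (x + \<epsilon> *\<^sub>R h) \<partial>lborel) / moment 0 p z"
proof -
  have "0 < measure lborel (ball (0 :: real ^ 'n) 1)"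
    using content_ball_pos[of 1 "0 :: real ^ 'n"] by simp
  moreover have "(LINT h:ball 0 1|lborel. pos_powr (z \<bullet> h) (p - 2)) = moment 0 p z"
    using LINT_ball_weight[of "\<lambda>_. 1" z p] by (simp add: weight_0_moment)
  ultimately show ?thesis
    by (simp add: Iop_def gam_def ball_avg_def LINT_ball_weight)
qed

text \<open>The iteration runs on total Borel functions; the explicit bound \<open>B\<close> is
  shared by all iterates and provides the dominating functions.\<close>

definition bounded_borel_by :: "real \<Rightarrow> (real ^ 'n \<Rightarrow> real) \<Rightarrow> bool" where
  "bounded_borel_by B u \<longleftrightarrow> u \<in> borel_measurable borel \<and> (\<forall>x. \<bar>u x\<bar> \<le> B)"

lemma integrable_weight_mult:
  fixes z :: "real ^ 'n"
  assumes "1 < p" "norm z = 1" "bounded_borel_by B u"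
  shows "integrable lborel (\<lambda>h. weight p z h * u (x + \<epsilon> *\<^sub>R h))"
proof (rule Bochner_Integration.integrable_bound)
  show "integrable lborel (\<lambda>h. B * weight p z h)"
    using integrable_weight[OF assms(1,2)] by simp
  have [measurable]: "u \<in> borel_measurable borel" and B: "\<bar>u y\<bar> \<le> B" for y
    using assms(3) by (auto simp: bounded_borel_by_def)
  show "(\<lambda>h. weight p z h * u (x + \<epsilon> *\<^sub>R h)) \<in> borel_measurable lborel"
    by measurable
  have "\<bar>weight p z h * u (x + \<epsilon> *\<^sub>R h)\<bar> \<le> \<bar>B * weight p z h\<bar>" for h
    using mult_right_mono[OF order_trans[OF B abs_ge_self], of "weight p z h" "x + \<epsilon> *\<^sub>R h"]
    by (simp add: abs_mult mult.commute)
  then show "AE h in lborel. norm (weight p z h * u (x + \<epsilon> *\<^sub>R h)) \<le> norm (B * weight p z h)"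
    by simp
qed

lemma Iop_mono:
  fixes z :: "real ^ 'n"
  assumes "1 < p" "norm z = 1" "bounded_borel_by B u" "bounded_borel_by B' v"
    and le: "\<And>h. norm h < 1 \<Longrightarrow> u (x + \<epsilon> *\<^sub>R h) \<le> v (x + \<epsilon> *\<^sub>R h)"
  shows "Iop p \<epsilon> z u x \<le> Iop p \<epsilon> z v x"
  unfolding Iop_eq
proof (intro divide_right_mono integral_mono integrable_weight_mult assms(1,2))
  show "weight p z h * u (x + \<epsilon> *\<^sub>R h) \<le> weight p z h * v (x + \<epsilon> *\<^sub>R h)" for h
    by (cases "norm h < 1") (auto intro!: mult_left_mono le simp: weight_eq_0)
  show "0 \<le> moment 0 p z"
    using moment_pos[OF assms(1,2), of 0] by simp
qed (use assms in auto)

lemma Iop_const: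
  fixes z :: "real ^ 'n"
  assumes "1 < p" "norm z = 1"
  shows "Iop p \<epsilon> z (\<lambda>_. c) x = c"
  using moment_pos[OF assms, of 0] by (simp add: Iop_eq weight_0_moment)

lemma Iop_uminus: "Iop p \<epsilon> z (\<lambda>y. - u y) x = - Iop p \<epsilon> z u x"
  by (simp add: Iop_eq)

text \<open>Comparison with the constants \<open>B\<close> and \<open>- B\<close>, which the
  normalised average reproduces.\<close>

lemma abs_Iop_le:
  fixes z :: "real ^ 'n"
  assumes p: "1 < p" and z: "norm z = 1" and u: "bounded_borel_by B u"
  shows "\<bar>Iop p \<epsilon> z u x\<bar> \<le> B"
proof -
  have "0 \<le> B" using u by (auto simp: bounded_borel_by_def intro: order_trans[OF abs_ge_zero])
  then have c: "bounded_borel_by B (\<lambda>_. c)" if "c = B \<or> c = - B" for c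
    using that by (auto simp: bounded_borel_by_def)
  have "Iop p \<epsilon> z u x \<le> Iop p \<epsilon> z (\<lambda>_. B) x" "Iop p \<epsilon> z (\<lambda>_. - B) x \<le> Iop p \<epsilon> z u x"
    using u by (auto intro!: Iop_mono[OF p z] c simp: bounded_borel_by_def abs_le_iff minus_le_iff)
  then show ?thesis by (simp add: Iop_const[OF p z] abs_le_iff)
qed

lemma Iop_measurable:
  fixes z :: "real ^ 'n"
  assumes "bounded_borel_by B u"
  shows "(\<lambda>x. Iop p \<epsilon> z u x) \<in> borel_measurable borel"
proof -
  have [measurable]: "u \<in> borel_measurable borel"
    using assms by (simp add: bounded_borel_by_def)
  show ?thesis unfolding Iop_eq by measurable
qed

text \<open>The weights for different directions have the same integral, so almost everywhere
  convergence (off the hyperplane orthogonal to \<open>z\<close>) upgrades to convergence in mean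
  by Scheffe's lemma; no dominating function is available when \<open>p < 2\<close>.\<close>

lemma Iop_tendsto:
  fixes z :: "real ^ 'n"
  assumes p: "1 < p" and z: "norm z = 1" "\<And>n. norm (Z n) = 1" "Z \<longlonglongrightarrow> z"
    and u: "\<And>n. bounded_borel_by B (u n)" "bounded_borel_by B v" "\<And>y. (\<lambda>n. u n y) \<longlonglongrightarrow> v y"
  shows "(\<lambda>n. Iop p \<epsilon> (Z n) (u n) x) \<longlonglongrightarrow> Iop p \<epsilon> z v x"
proof -
  have [measurable]: "u n \<in> borel_measurable borel" "v \<in> borel_measurable borel"
    and B: "\<bar>u n y\<bar> \<le> B" for n y
    using u by (auto simp: bounded_borel_by_def)
  have nn: "(\<integral>\<^sup>+h. weight p w h \<partial>lborel) = moment 0 p z" if "norm w = 1" for w :: "real ^ 'n"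
    using nn_integral_eq_integral[OF integrable_weight[OF p that]] moment_unit_indep[OF that z(1), of 0 p]
    by (simp add: weight_0_moment)
  have ae: "AE h in lborel. (\<lambda>n. weight p (Z n) h) \<longlonglongrightarrow> weight p z h"
  proof -
    \<comment> \<open>On this hyperplane convergence can fail for p \<le> 2: nearby directions may
      give values that jump to 1 or blow up.\<close>
    have "negligible {h. z \<bullet> h = 0}"
      using z by (intro negligible_hyperplane) auto
    then have "AE h in lborel. h \<notin> {h. z \<bullet> h = 0}"
      using AE_not_in[of "{h. z \<bullet> h = 0}" lebesgue]
      by (simp add: negligible_iff_null_sets AE_completion_iff)
    then show ?thesis
    proof eventually_elim
      case (elim h)
      have lim: "(\<lambda>n. Z n \<bullet> h) \<longlonglongrightarrow> z \<bullet> h"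
        by (intro tendsto_intros z)
      have "(\<lambda>n. pos_powr (Z n \<bullet> h) (p - 2)) \<longlonglongrightarrow> pos_powr (z \<bullet> h) (p - 2)"
      proof (cases "0 < z \<bullet> h")
        case True
        have "eventually (\<lambda>n. 0 < Z n \<bullet> h) sequentially"
          using order_tendstoD(1)[OF lim True] .
        then have "eventually (\<lambda>n. (Z n \<bullet> h) powr (p - 2) = pos_powr (Z n \<bullet> h) (p - 2)) sequentially"
          by eventually_elim (simp add: pos_powr_def)
        moreover have "(\<lambda>n. (Z n \<bullet> h) powr (p - 2)) \<longlonglongrightarrow> (z \<bullet> h) powr (p - 2)"
          using True by (intro tendsto_intros lim) simp
        ultimately show ?thesis
          using True by (simp add: pos_powr_def[of "z \<bullet> h"] tendsto_cong)
      next
        case False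
        \<comment> \<open>On the negative side the weights for \<open>Z n\<close> are eventually 0,
          so the size of the exponent does not matter.\<close>
        with elim have "z \<bullet> h < 0" by simp
        from order_tendstoD(2)[OF lim this]
        have "eventually (\<lambda>n. 0 = pos_powr (Z n \<bullet> h) (p - 2)) sequentially"
          by eventually_elim (simp add: pos_powr_def)
        then have "(\<lambda>n. pos_powr (Z n \<bullet> h) (p - 2)) \<longlonglongrightarrow> 0"
          by (rule tendsto_eventually[OF eventually_mono]) simp
        then show ?thesis
          using False by (simp add: pos_powr_def[of "z \<bullet> h"])
      qed
      then show ?case unfolding weight_def by (intro tendsto_intros)
    qed
  qed
  have "(\<lambda>n. \<integral>\<^sup>+h. norm (weight p (Z n) h - weight p z h) \<partial>lborel) \<longlonglongrightarrow> 0"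
    by (rule Scheffe_lemma2) (use integrable_weight[OF p z(1)] ae in \<open>simp_all add: nn z\<close>)
  moreover have "(\<integral>\<^sup>+h. norm (weight p (Z n) h - weight p z h) \<partial>lborel) =
      ennreal (\<integral>h. \<bar>weight p (Z n) h - weight p z h\<bar> \<partial>lborel)" for n
    using nn_integral_eq_integral[of lborel "\<lambda>h. \<bar>weight p (Z n) h - weight p z h\<bar>"]
      integrable_weight[OF p z(1)] integrable_weight[OF p z(2)] by simp
  ultimately have L1: "(\<lambda>n. \<integral>h. \<bar>weight p (Z n) h - weight p z h\<bar> \<partial>lborel) \<longlonglongrightarrow> 0"
    by (simp add: ennreal_tendsto_0_iff)
  \<comment> \<open>The convergence is split in two: here only the weight changes, and the error is
    at most \<open>B\<close> times the distance of the weights in mean; afterwards the weight is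
    fixed and dominated convergence applies.\<close>
  have "(\<lambda>n. (\<integral>h. weight p (Z n) h * u n (x + \<epsilon> *\<^sub>R h) \<partial>lborel) -
      (\<integral>h. weight p z h * u n (x + \<epsilon> *\<^sub>R h) \<partial>lborel)) \<longlonglongrightarrow> 0"
  proof (rule Lim_null_comparison[OF always_eventually])
    show "(\<lambda>n. B * (\<integral>h. \<bar>weight p (Z n) h - weight p z h\<bar> \<partial>lborel)) \<longlonglongrightarrow> 0"
      using tendsto_mult_right_zero[OF L1] .
    show "\<forall>n. norm ((\<integral>h. weight p (Z n) h * u n (x + \<epsilon> *\<^sub>R h) \<partial>lborel) -
        (\<integral>h. weight p z h * u n (x + \<epsilon> *\<^sub>R h) \<partial>lborel)) \<le>
        B * (\<integral>h. \<bar>weight p (Z n) h - weight p z h\<bar> \<partial>lborel)"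
    proof
      fix n
      note i = integrable_weight_mult[OF p z(2) u(1), of n n x \<epsilon>] integrable_weight_mult[OF p z(1) u(1), of n x \<epsilon>]
      have "\<bar>(\<integral>h. weight p (Z n) h * u n (x + \<epsilon> *\<^sub>R h) \<partial>lborel) -
          (\<integral>h. weight p z h * u n (x + \<epsilon> *\<^sub>R h) \<partial>lborel)\<bar> =
          \<bar>\<integral>h. weight p (Z n) h * u n (x + \<epsilon> *\<^sub>R h) - weight p z h * u n (x + \<epsilon> *\<^sub>R h) \<partial>lborel\<bar>"
        using i by simp
      also have "\<dots> \<le> (\<integral>h. B * \<bar>weight p (Z n) h - weight p z h\<bar> \<partial>lborel)"
      proof (rule order_trans[OF integral_abs_bound integral_mono])
        show "integrable lborel (\<lambda>h. \<bar>weight p (Z n) h * u n (x + \<epsilon> *\<^sub>R h) - weight p z h * u n (x + \<epsilon> *\<^sub>R h)\<bar>)"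
          using i by simp
        show "integrable lborel (\<lambda>h. B * \<bar>weight p (Z n) h - weight p z h\<bar>)"
          using integrable_weight[OF p z(1)] integrable_weight[OF p z(2)] by simp
        show "\<bar>weight p (Z n) h * u n (x + \<epsilon> *\<^sub>R h) - weight p z h * u n (x + \<epsilon> *\<^sub>R h)\<bar> \<le>
            B * \<bar>weight p (Z n) h - weight p z h\<bar>" for h
          using B by (simp add: abs_mult mult.commute[of B] mult_left_mono flip: left_diff_distrib)
      qed
      finally show "norm ((\<integral>h. weight p (Z n) h * u n (x + \<epsilon> *\<^sub>R h) \<partial>lborel) -
        (\<integral>h. weight p z h * u n (x + \<epsilon> *\<^sub>R h) \<partial>lborel)) \<le>
        B * (\<integral>h. \<bar>weight p (Z n) h - weight p z h\<bar> \<partial>lborel)" by simp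
    qed
  qed
  moreover have "(\<lambda>n. \<integral>h. weight p z h * u n (x + \<epsilon> *\<^sub>R h) \<partial>lborel)
      \<longlonglongrightarrow> (\<integral>h. weight p z h * v (x + \<epsilon> *\<^sub>R h) \<partial>lborel)"
  proof (rule integral_dominated_convergence)
    show "integrable lborel (\<lambda>h. B * weight p z h)"
      using integrable_weight[OF p z(1)] by simp
    show "AE h in lborel. (\<lambda>n. weight p z h * u n (x + \<epsilon> *\<^sub>R h)) \<longlonglongrightarrow> weight p z h * v (x + \<epsilon> *\<^sub>R h)"
      by (intro AE_I2 tendsto_intros u)
    show "AE h in lborel. norm (weight p z h * u n (x + \<epsilon> *\<^sub>R h)) \<le> B * weight p z h" for n
      using B by (intro AE_I2) (simp add: abs_mult mult.commute[of B] mult_left_mono)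
  qed measurable
  ultimately have "(\<lambda>n. \<integral>h. weight p (Z n) h * u n (x + \<epsilon> *\<^sub>R h) \<partial>lborel)
      \<longlonglongrightarrow> (\<integral>h. weight p z h * v (x + \<epsilon> *\<^sub>R h) \<partial>lborel)"
    by (rule Lim_transform[rotated])
  then show ?thesis
    \<comment> \<open>The normalising moment is the same positive number for every
      \<open>Z n\<close>, so only the numerators vary.\<close>
    using moment_pos[OF p z(1), of 0]
    unfolding Iop_eq moment_unit_indep[OF z(2) z(1), of 0 p for n]
    by (intro tendsto_intros) auto
qed

section \<open>Suprema and infima over the unit sphere\<close>

lemma bounded_borel_by_uminus: "bounded_borel_by B u \<Longrightarrow> bounded_borel_by B (\<lambda>y. - u y)"
  by (simp add: bounded_borel_by_def)

lemma Iop_bdd: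
  fixes u :: "real ^ 'n \<Rightarrow> real"
  assumes "1 < p" "bounded_borel_by B u"
  shows "bdd_above ((\<lambda>z. Iop p \<epsilon> z u x) ` {z. norm z = 1})"
    and "bdd_below ((\<lambda>z. Iop p \<epsilon> z u x) ` {z. norm z = 1})"
  using abs_Iop_le[OF assms(1) _ assms(2), of _ \<epsilon> x]
  by (auto intro!: bdd_aboveI2[of _ _ B] bdd_belowI2[of _ "- B"] simp: abs_le_iff minus_le_iff)

lemma unit_sphere_nonempty: "{z :: real ^ 'n. norm z = 1} \<noteq> {}"
  using vector_choose_size[of 1] by auto

lemma compact_unit_sphere: "compact {z :: real ^ 'n. norm z = 1}"
  using compact_sphere[of "0 :: real ^ 'n" 1] by (simp add: sphere_def)

text \<open>Reflection in the function values; it transfers every fact about suprema to infima. On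
  the reals \<open>Inf\<close> is defined by such a reflection, so no boundedness enters.\<close>

lemma INF_Iop_eq:
  "(INF z\<in>S. Iop p \<epsilon> z u x) = - (SUP z\<in>S. Iop p \<epsilon> z (\<lambda>y. - u y) x)"
  by (simp add: Inf_real_def image_image Iop_uminus)

text \<open>By sequential continuity each value on \<open>S\<close> is a limit of values on
  \<open>D\<close>, hence at most the supremum over \<open>D\<close>.\<close>

lemma SUP_dense_eq:
  fixes F :: "'a::metric_space \<Rightarrow> real"
  assumes "D \<subseteq> S" "S \<subseteq> closure D" "S \<noteq> {}" and bdd: "bdd_above (F ` S)"
    and F: "\<And>Z z. (\<And>n::nat. Z n \<in> S) \<Longrightarrow> z \<in> S \<Longrightarrow> Z \<longlonglongrightarrow> z \<Longrightarrow> (\<lambda>n. F (Z n)) \<longlonglongrightarrow> F z"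
  shows "(SUP z\<in>S. F z) = (SUP z\<in>D. F z)"
proof (rule antisym)
  have D: "D \<noteq> {}" "bdd_above (F ` D)"
    using assms(1-3) bdd_above_mono[OF bdd image_mono] by auto
  show "(SUP z\<in>S. F z) \<le> (SUP z\<in>D. F z)"
  proof (rule cSUP_least[OF \<open>S \<noteq> {}\<close>])
    fix z assume "z \<in> S"
    then obtain Z where Z: "\<And>n. Z n \<in> D" "Z \<longlonglongrightarrow> z"
      using assms(2) closure_sequential[of z D] by auto
    then have "(\<lambda>n. F (Z n)) \<longlonglongrightarrow> F z"
      using assms(1) \<open>z \<in> S\<close> by (intro F) auto
    then show "F z \<le> (SUP z\<in>D. F z)"
      by (rule LIMSEQ_le_const2) (auto intro!: cSUP_upper Z D)
  qed
  show "(SUP z\<in>D. F z) \<le> (SUP z\<in>S. F z)"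
    using assms(1) D bdd by (intro cSUP_subset_mono) auto
qed

lemma SUP_Iop_measurable:
  fixes u :: "real ^ 'n \<Rightarrow> real"
  assumes p: "1 < p" and u: "bounded_borel_by B u"
  shows "(\<lambda>x. SUP z\<in>{z. norm z = 1}. Iop p \<epsilon> z u x) \<in> borel_measurable borel"
proof -
  obtain D :: "(real ^ 'n) set"
    where D: "countable D" "D \<subseteq> {z. norm z = 1}" "{z. norm z = 1} \<subseteq> closure D"
    using separable by blast
  \<comment> \<open>Continuity in the direction is \<open>Iop_tendsto\<close> for the constant
    sequence \<open>u\<close>.\<close>
  have "(SUP z\<in>{z. norm z = 1}. Iop p \<epsilon> z u x) = (SUP z\<in>D. Iop p \<epsilon> z u x)" for x
    by (rule SUP_dense_eq[OF D(2,3) unit_sphere_nonempty Iop_bdd(1)[OF p u]])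
      (rule Iop_tendsto[OF p _ _ _ u u], auto)
  moreover have "(\<lambda>x. SUP z\<in>D. Iop p \<epsilon> z u x) \<in> borel_measurable borel"
    by (intro borel_measurable_cSUP D(1) Iop_measurable[OF u]
        bdd_above_mono[OF Iop_bdd(1)[OF p u] image_mono[OF D(2)]])
  ultimately show ?thesis by simp
qed

text \<open>The supremum is 1-Lipschitz for the uniform distance; thus uniform convergence over the
  sphere passes to suprema.\<close>

lemma abs_SUP_diff_le:
  fixes F G :: "'a \<Rightarrow> real"
  assumes "S \<noteq> {}" "bdd_above (F ` S)" "bdd_above (G ` S)" "\<And>z. z \<in> S \<Longrightarrow> \<bar>F z - G z\<bar> \<le> e"
  shows "\<bar>(SUP z\<in>S. F z) - (SUP z\<in>S. G z)\<bar> \<le> e"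
proof -
  have "F z \<le> (SUP z\<in>S. G z) + e" "G z \<le> (SUP z\<in>S. F z) + e" if "z \<in> S" for z
    using cSUP_upper[OF that assms(2)] cSUP_upper[OF that assms(3)] assms(4)[OF that] by linarith+
  then have "(SUP z\<in>S. F z) \<le> (SUP z\<in>S. G z) + e" "(SUP z\<in>S. G z) \<le> (SUP z\<in>S. F z) + e"
    using assms(1) by (auto intro: cSUP_least)
  then show ?thesis by linarith
qed

text \<open>If convergence were not uniform in \<open>z\<close>, directions with error at least
  \<open>e\<close> would accumulate at some \<open>z\<close> by compactness. Along that subsequence
  the averages of \<open>u n\<close> and of \<open>v\<close> both tend to the average of
  \<open>v\<close> along \<open>z\<close>, a contradiction.\<close>

lemma SUP_Iop_tendsto:
  fixes u :: "nat \<Rightarrow> real ^ 'n \<Rightarrow> real"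
  assumes p: "1 < p" and u: "\<And>n. bounded_borel_by B (u n)" "bounded_borel_by B v"
    and lim: "\<And>y. (\<lambda>n. u n y) \<longlonglongrightarrow> v y"
  shows "(\<lambda>n. SUP z\<in>{z. norm z = 1}. Iop p \<epsilon> z (u n) x)
    \<longlonglongrightarrow> (SUP z\<in>{z. norm z = 1}. Iop p \<epsilon> z v x)"
proof -
  define S where "S = {z :: real ^ 'n. norm z = 1}"
  have unif: "eventually (\<lambda>n. \<forall>z\<in>S. \<bar>Iop p \<epsilon> z (u n) x - Iop p \<epsilon> z v x\<bar> < e) sequentially"
    if e: "e > 0" for e
  proof (rule ccontr)
    assume "\<not> eventually (\<lambda>n. \<forall>z\<in>S. \<bar>Iop p \<epsilon> z (u n) x - Iop p \<epsilon> z v x\<bar> < e) sequentially"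
    then have "\<forall>m. \<exists>n\<ge>m. \<exists>z\<in>S. e \<le> \<bar>Iop p \<epsilon> z (u n) x - Iop p \<epsilon> z v x\<bar>"
      unfolding eventually_sequentially by (meson not_less)
    then obtain r Z where r: "\<And>m. m \<le> r m" and Z: "\<And>m::nat. Z m \<in> S"
      and far: "\<And>m. e \<le> \<bar>Iop p \<epsilon> (Z m) (u (r m)) x - Iop p \<epsilon> (Z m) v x\<bar>"
      by metis
    have "seq_compact S"
      using compact_unit_sphere by (simp add: S_def compact_eq_seq_compact_metric)
    then obtain z s where s: "z \<in> S" "strict_mono s" "(Z \<circ> s) \<longlonglongrightarrow> z"
      using Z unfolding seq_compact_def by metis
    \<comment> \<open>The indices \<open>r m\<close> need not increase; that \<open>r m\<close> is
      at least \<open>m\<close> suffices to reach infinity.\<close>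
    have "filterlim (\<lambda>m. r (s m)) at_top sequentially"
      by (rule filterlim_at_top_mono[OF filterlim_subseq[OF s(2)]]) (simp add: r)
    then have ur: "(\<lambda>m. u (r (s m)) y) \<longlonglongrightarrow> v y" for y
      by (rule filterlim_compose[OF lim])
    have "(\<lambda>m. Iop p \<epsilon> (Z (s m)) (u (r (s m))) x) \<longlonglongrightarrow> Iop p \<epsilon> z v x"
      by (rule Iop_tendsto[OF p _ _ _ u(1) u(2) ur]) (use s Z in \<open>auto simp: S_def o_def\<close>)
    moreover have "(\<lambda>m. Iop p \<epsilon> (Z (s m)) v x) \<longlonglongrightarrow> Iop p \<epsilon> z v x"
      by (rule Iop_tendsto[OF p _ _ _ u(2) u(2)]) (use s Z in \<open>auto simp: S_def o_def\<close>)
    ultimately have "(\<lambda>m. \<bar>Iop p \<epsilon> (Z (s m)) (u (r (s m))) x - Iop p \<epsilon> (Z (s m)) v x\<bar>)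
        \<longlonglongrightarrow> \<bar>Iop p \<epsilon> z v x - Iop p \<epsilon> z v x\<bar>"
      by (intro tendsto_rabs tendsto_diff)
    then have "(\<lambda>m. \<bar>Iop p \<epsilon> (Z (s m)) (u (r (s m))) x - Iop p \<epsilon> (Z (s m)) v x\<bar>) \<longlonglongrightarrow> 0"
      by simp
    then have "e \<le> 0"
      by (rule LIMSEQ_le_const) (use far in auto)
    with e show False by simp
  qed
  show ?thesis
  proof (rule tendstoI)
    fix e :: real assume "e > 0"
    \<comment> \<open>Passing to suprema keeps only a weak inequality, so half of \<open>e\<close>
      is used to end with a strict one.\<close>
    then have "e / 2 > 0" by simp
    from unif[OF this]
    show "eventually (\<lambda>n. dist (SUP z\<in>{z. norm z = 1}. Iop p \<epsilon> z (u n) x)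
        (SUP z\<in>{z. norm z = 1}. Iop p \<epsilon> z v x) < e) sequentially"
    proof eventually_elim
      case (elim n)
      then have "\<bar>(SUP z\<in>{z. norm z = 1}. Iop p \<epsilon> z (u n) x) - (SUP z\<in>{z. norm z = 1}. Iop p \<epsilon> z v x)\<bar>
          \<le> e / 2"
        by (intro abs_SUP_diff_le unit_sphere_nonempty Iop_bdd[OF p u(1)] Iop_bdd[OF p u(2)])
          (auto simp: S_def intro: less_imp_le)
      then show ?case
        using \<open>e > 0\<close> by (simp add: dist_real_def)
    qed
  qed
qed

section \<open>Opposite directions applied to a paraboloid\<close>

text \<open>Substituting \<open>- h\<close> for \<open>h\<close> turns the average along
  \<open>- z\<close> into that of \<open>u (x - \<epsilon> *\<^sub>R h)\<close> along
  \<open>z\<close>. In the sum the terms linear in \<open>h\<close> cancel, leaving the second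
  moment.\<close>

lemma Iop_quadratic:
  fixes z :: "real ^ 'n"
  assumes p: "1 < p" and z: "norm z = 1" and u: "bounded_borel_by B u"
    and q: "\<And>h. norm h < 1 \<Longrightarrow> u (x + \<epsilon> *\<^sub>R h) = C - A * (norm (x + \<epsilon> *\<^sub>R h))\<^sup>2"
  shows "Iop p \<epsilon> z u x + Iop p \<epsilon> (- z) u x =
    2 * (C - A * (norm x)\<^sup>2) - 2 * A * \<epsilon>\<^sup>2 * (moment 2 p z / moment 0 p z)"
proof -
  have [measurable]: "u \<in> borel_measurable borel"
    using u by (simp add: bounded_borel_by_def)
  have orth: "orthogonal_transformation (\<lambda>h :: real ^ 'n. - h)"
    by (simp add: orthogonal_transformation_def linear_uminus)
  have wm: "weight p (- z) (- h) = weight p z h" for h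
    by (rule weight_orthogonal[OF orth])
  have "(\<integral>h. weight p (- z) h * u (x + \<epsilon> *\<^sub>R h) \<partial>lborel) =
      (\<integral>h. weight p (- z) (- h) * u (x + \<epsilon> *\<^sub>R - h) \<partial>lborel)"
    by (rule lborel_integral_orthogonal[OF orth, symmetric]) measurable
  then have minus: "(\<integral>h. weight p (- z) h * u (x + \<epsilon> *\<^sub>R h) \<partial>lborel) =
      (\<integral>h. weight p z h * u (x - \<epsilon> *\<^sub>R h) \<partial>lborel)"
    by (simp add: wm)
  have "(\<integral>h. weight p z h * u (x + \<epsilon> *\<^sub>R h) \<partial>lborel) + (\<integral>h. weight p z h * u (x - \<epsilon> *\<^sub>R h) \<partial>lborel)
      = (\<integral>h. weight p z h * u (x + \<epsilon> *\<^sub>R h) + weight p z h * u (x - \<epsilon> *\<^sub>R h) \<partial>lborel)"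
    \<comment> \<open>The reflected integrand is the same expression with
      \<open>- \<epsilon>\<close> in place of \<open>\<epsilon>\<close>.\<close>
    using integrable_weight_mult[OF p z u, of x \<epsilon>] integrable_weight_mult[OF p z u, of x "- \<epsilon>"]
    by simp
  also have "\<dots> = (\<integral>h. 2 * (C - A * (norm x)\<^sup>2) * weight p z h -
      2 * A * \<epsilon>\<^sup>2 * ((norm h)\<^sup>2 * weight p z h) \<partial>lborel)"
  proof (intro Bochner_Integration.integral_cong refl)
    fix h :: "real ^ 'n"
    show "weight p z h * u (x + \<epsilon> *\<^sub>R h) + weight p z h * u (x - \<epsilon> *\<^sub>R h) =
        2 * (C - A * (norm x)\<^sup>2) * weight p z h - 2 * A * \<epsilon>\<^sup>2 * ((norm h)\<^sup>2 * weight p z h)"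
    proof (cases "norm h < 1")
      case True
      \<comment> \<open>The parallelogram law.\<close>
      have par: "(norm (x + \<epsilon> *\<^sub>R h))\<^sup>2 + (norm (x - \<epsilon> *\<^sub>R h))\<^sup>2 = 2 * (norm x)\<^sup>2 + 2 * \<epsilon>\<^sup>2 * (norm h)\<^sup>2"
        unfolding power2_norm_eq_inner
        by (simp add: inner_simps inner_commute[of h x]) (simp add: algebra_simps power2_eq_square)
      have "u (x + \<epsilon> *\<^sub>R h) + u (x - \<epsilon> *\<^sub>R h) =
          2 * C - A * ((norm (x + \<epsilon> *\<^sub>R h))\<^sup>2 + (norm (x - \<epsilon> *\<^sub>R h))\<^sup>2)"
        using q[OF True] q[of "- h"] True by (simp add: algebra_simps)
      then have "u (x + \<epsilon> *\<^sub>R h) + u (x - \<epsilon> *\<^sub>R h) =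
          2 * (C - A * (norm x)\<^sup>2) - 2 * A * \<epsilon>\<^sup>2 * (norm h)\<^sup>2"
        unfolding par by (simp add: algebra_simps)
      then show ?thesis
        by (simp flip: distrib_left) (simp add: algebra_simps)
    qed (simp add: weight_eq_0)
  qed
  also have "\<dots> = 2 * (C - A * (norm x)\<^sup>2) * moment 0 p z - 2 * A * \<epsilon>\<^sup>2 * moment 2 p z"
    using integrable_weight[OF p z] integrable_moment[OF p z, of 2]
    by (simp add: weight_0_moment flip: moment_def)
  finally show ?thesis
    using moment_pos[OF p z, of 0] moment_unit_indep[of "- z" z 0 p] z
    by (simp add: Iop_eq minus field_simps)
qed

section \<open>Neighbourhoods of the domain and extension by zero\<close>

lemma nbhd_shift:
  assumes "0 < \<epsilon>" "x \<in> \<Omega>" "norm h < 1"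
  shows "x + \<epsilon> *\<^sub>R h \<in> nbhd \<epsilon> \<Omega>"
proof -
  have "infdist (x + \<epsilon> *\<^sub>R h) \<Omega> \<le> dist (x + \<epsilon> *\<^sub>R h) x"
    using assms(2) by (rule infdist_le)
  also have "\<dots> < \<epsilon>"
    using assms by (simp add: dist_norm)
  finally show ?thesis by (simp add: nbhd_def)
qed

lemma open_nbhd: "open (nbhd \<epsilon> \<Omega>)"
  unfolding nbhd_def by (intro open_Collect_less continuous_intros)

lemma subset_nbhd: "0 < \<epsilon> \<Longrightarrow> \<Omega> \<subseteq> nbhd \<epsilon> \<Omega>"
  by (auto simp: nbhd_def)

text \<open>Nonemptiness matters: \<open>infdist\<close> to the empty set is 0, so for positive
  \<open>\<epsilon>\<close> its neighbourhood would be the whole space.\<close>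

lemma bounded_nbhd:
  assumes "bounded \<Omega>" "\<Omega> \<noteq> {}"
  shows "bounded (nbhd \<epsilon> \<Omega>)"
proof -
  obtain R where R: "\<And>y. y \<in> \<Omega> \<Longrightarrow> norm y \<le> R"
    using assms(1) by (auto simp: bounded_iff)
  have "norm x \<le> R + \<epsilon>" if "x \<in> nbhd \<epsilon> \<Omega>" for x
  proof -
    have "infdist x \<Omega> < \<epsilon>" using that by (simp add: nbhd_def)
    then obtain y where "y \<in> \<Omega>" "dist x y < \<epsilon>"
      using assms(2) by (auto simp: infdist_def cINF_less_iff)
    then show ?thesis
      using R[of y] norm_triangle_sub[of x y] by (simp add: dist_norm)
  qed
  then show ?thesis by (auto simp: bounded_iff)
qed

lemma bounded_borel_on_bound:
  assumes "bounded_borel_on S u"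
  obtains M where "0 \<le> M" "\<And>x. x \<in> S \<Longrightarrow> \<bar>u x\<bar> \<le> M"
proof -
  obtain M where "\<And>x. x \<in> S \<Longrightarrow> \<bar>u x\<bar> \<le> M"
    using assms by (auto simp: bounded_borel_on_def bounded_iff)
  then show thesis
    \<comment> \<open>If \<open>S\<close> is empty, \<open>M\<close> may be negative; the maximum
      secures the sign.\<close>
    by (intro that[of "max M 0"]) fastforce+
qed

lemma bounded_borel_on_extend:
  assumes "bounded_borel_on S u" "S \<in> sets borel"
  shows "(\<lambda>x. if x \<in> S then u x else 0) \<in> borel_measurable borel"
proof -
  have "(\<lambda>x. indicator S x *\<^sub>R u x) \<in> borel_measurable borel"
    using assms by (simp add: bounded_borel_on_def borel_measurable_restrict_space_iff)
  moreover have "(\<lambda>x. indicator S x *\<^sub>R u x) = (\<lambda>x. if x \<in> S then u x else 0)"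
    by (auto simp: fun_eq_iff)
  ultimately show ?thesis by simp
qed

section \<open>The tug-of-war operator and its barrier\<close>

text \<open>Boundary values are part of the operator, so a fixed point solves both equations at
  once. The value 0 off the neighbourhood keeps the functions total, Borel and bounded.\<close>

definition tug_step ::
  "real \<Rightarrow> real \<Rightarrow> (real ^ 'n) set \<Rightarrow> (real ^ 'n \<Rightarrow> real) \<Rightarrow> (real ^ 'n \<Rightarrow> real) \<Rightarrow>
    (real ^ 'n \<Rightarrow> real) \<Rightarrow> real ^ 'n \<Rightarrow> real" where
  "tug_step p \<epsilon> \<Omega> f g u x =
    (if x \<in> \<Omega> then 1 / 2 * ((SUP z\<in>{z. norm z = 1}. Iop p \<epsilon> z u x)
       + (INF z\<in>{z. norm z = 1}. Iop p \<epsilon> z u x)) + \<epsilon>\<^sup>2 * f x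
     else if x \<in> Gam \<epsilon> \<Omega> then g x else 0)"

lemma tug_step_measurable:
  assumes p: "1 < p" and u: "bounded_borel_by B u" and \<Omega>: "open \<Omega>"
    and f: "bounded_borel_on \<Omega> f" and g: "bounded_borel_on (Gam \<epsilon> \<Omega>) g"
  shows "tug_step p \<epsilon> \<Omega> f g u \<in> borel_measurable borel"
proof -
  have sets: "\<Omega> \<in> sets borel" "Gam \<epsilon> \<Omega> \<in> sets borel"
    using \<Omega> open_nbhd[of \<epsilon> \<Omega>] by (auto simp: Gam_def)
  note [measurable] = sets bounded_borel_on_extend[OF f sets(1)] bounded_borel_on_extend[OF g sets(2)]
    SUP_Iop_measurable[OF p u] SUP_Iop_measurable[OF p bounded_borel_by_uminus[OF u]]
  \<comment> \<open>Since \<open>f\<close> and \<open>g\<close> are measurable only on their own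
    domains, the operator is written as a sum of pieces extended by 0.\<close>
  have "tug_step p \<epsilon> \<Omega> f g u = (\<lambda>x.
      (if x \<in> \<Omega> then 1 / 2 * ((SUP z\<in>{z. norm z = 1}. Iop p \<epsilon> z u x)
        - (SUP z\<in>{z. norm z = 1}. Iop p \<epsilon> z (\<lambda>y. - u y) x)) else 0)
      + \<epsilon>\<^sup>2 * (if x \<in> \<Omega> then f x else 0) + (if x \<in> Gam \<epsilon> \<Omega> then g x else 0))"
    by (auto simp: fun_eq_iff tug_step_def INF_Iop_eq Gam_def)
  also have "\<dots> \<in> borel_measurable borel"
    by measurable
  finally show ?thesis .
qed

lemma tug_step_mono:
  assumes p: "1 < p" and u: "bounded_borel_by B u" and v: "bounded_borel_by B v"
    and le: "\<And>y. u y \<le> v y"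
  shows "tug_step p \<epsilon> \<Omega> f g u x \<le> tug_step p \<epsilon> \<Omega> f g v x"
proof -
  have *: "Iop p \<epsilon> z u x \<le> Iop p \<epsilon> z v x" if "norm z = 1" for z
    by (rule Iop_mono[OF p that u v le])
  have "(SUP z\<in>{z. norm z = 1}. Iop p \<epsilon> z u x) \<le> (SUP z\<in>{z. norm z = 1}. Iop p \<epsilon> z v x)"
    using * by (intro cSUP_mono unit_sphere_nonempty Iop_bdd[OF p v]) auto
  moreover have "(INF z\<in>{z. norm z = 1}. Iop p \<epsilon> z u x) \<le> (INF z\<in>{z. norm z = 1}. Iop p \<epsilon> z v x)"
    using * by (intro cINF_mono unit_sphere_nonempty Iop_bdd[OF p u]) auto
  ultimately show ?thesis
    by (simp add: tug_step_def)
qed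

lemma tug_step_tendsto:
  assumes p: "1 < p" and u: "\<And>n. bounded_borel_by B (u n)" "bounded_borel_by B v"
    and lim: "\<And>y. (\<lambda>n. u n y) \<longlonglongrightarrow> v y"
  shows "(\<lambda>n. tug_step p \<epsilon> \<Omega> f g (u n) x) \<longlonglongrightarrow> tug_step p \<epsilon> \<Omega> f g v x"
proof -
  have "(\<lambda>n. SUP z\<in>{z. norm z = 1}. Iop p \<epsilon> z (\<lambda>y. - u n y) x)
      \<longlonglongrightarrow> (SUP z\<in>{z. norm z = 1}. Iop p \<epsilon> z (\<lambda>y. - v y) x)"
    by (rule SUP_Iop_tendsto[OF p bounded_borel_by_uminus bounded_borel_by_uminus tendsto_minus, OF u lim])
  with SUP_Iop_tendsto[OF p u lim, of \<epsilon> x] show ?thesis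
    unfolding tug_step_def INF_Iop_eq
    by (cases "x \<in> \<Omega>") (simp_all only: if_True if_False add_uminus_conv_diff
        tendsto_add tendsto_diff tendsto_mult tendsto_const)
qed

text \<open>Comparing each direction with its opposite turns the tug-of-war operator into a symmetric
  average, for which a steep enough concave paraboloid is a supersolution.\<close>

lemma ex_tug_barrier:
  fixes f g :: "real ^ 'n \<Rightarrow> real"
  assumes p: "1 < p" and \<epsilon>: "0 < \<epsilon>" and \<Omega>: "open \<Omega>" "bounded \<Omega>" "\<Omega> \<noteq> {}"
    and f: "bounded_borel_on \<Omega> f" and g: "bounded_borel_on (Gam \<epsilon> \<Omega>) g"
  obtains B q where "bounded_borel_by B q" "\<And>x. 0 \<le> q x"
    "\<And>x. tug_step p \<epsilon> \<Omega> f g q x \<le> q x"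
    "\<And>x. - q x \<le> tug_step p \<epsilon> \<Omega> f g (\<lambda>y. - q y) x"
proof -
  obtain Mf where Mf: "0 \<le> Mf" "\<And>x. x \<in> \<Omega> \<Longrightarrow> \<bar>f x\<bar> \<le> Mf"
    using bounded_borel_on_bound[OF f] by blast
  obtain Mg where Mg: "0 \<le> Mg" "\<And>x. x \<in> Gam \<epsilon> \<Omega> \<Longrightarrow> \<bar>g x\<bar> \<le> Mg"
    using bounded_borel_on_bound[OF g] by blast
  obtain R where R: "\<And>x. x \<in> nbhd \<epsilon> \<Omega> \<Longrightarrow> norm x \<le> R"
    using bounded_nbhd[OF \<Omega>(2,3)] unfolding bounded_iff by blast
  \<comment> \<open>The vector \<open>axis undefined 1\<close> is just some unit vector; the ratio
    is the same for all of them.\<close>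
  define \<kappa> where "\<kappa> = moment 2 p (axis undefined 1 :: real ^ 'n) / moment 0 p (axis undefined 1 :: real ^ 'n)"
  have \<kappa>: "moment 2 p z / moment 0 p z = \<kappa>" if "norm z = 1" for z :: "real ^ 'n"
    using moment_unit_indep[OF that, of "axis undefined 1"] by (simp add: \<kappa>_def)
  have "0 < \<kappa>"
    unfolding \<kappa>_def by (intro divide_pos_pos moment_pos[OF p]) simp_all
  \<comment> \<open>With this steepness, averaging over two opposite directions lowers the
    paraboloid by exactly \<open>\<epsilon>\<^sup>2 * Mf\<close>, enough to absorb the source
    term.\<close>
  define A where "A = Mf / \<kappa>"
  have A: "0 \<le> A" "A * \<kappa> = Mf"
    using \<open>0 < \<kappa>\<close> Mf(1) by (simp_all add: A_def)
  \<comment> \<open>The height makes \<open>q\<close> at least \<open>Mg\<close> on the whole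
    neighbourhood, so \<open>q\<close> dominates the boundary data and is nonnegative.\<close>
  define C where "C = Mg + A * R\<^sup>2"
  define q where "q x = (if x \<in> nbhd \<epsilon> \<Omega> then C - A * (norm x)\<^sup>2 else 0)" for x :: "real ^ 'n"
  have q_ge: "Mg \<le> q x" if "x \<in> nbhd \<epsilon> \<Omega>" for x
  proof -
    have "A * (norm x)\<^sup>2 \<le> A * R\<^sup>2"
      using R[OF that] A(1) by (intro mult_left_mono power_mono) auto
    then show ?thesis using that by (simp add: q_def C_def)
  qed
  have q0: "0 \<le> q x" for x
    using q_ge[of x] Mg(1) by (cases "x \<in> nbhd \<epsilon> \<Omega>") (auto simp: q_def)
  have [measurable]: "nbhd \<epsilon> \<Omega> \<in> sets borel"
    using open_nbhd by (rule borel_open)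
  have "q \<in> borel_measurable borel"
    unfolding q_def[abs_def] by measurable
  moreover have "\<bar>q x\<bar> \<le> C" for x
    using q0[of x] A(1) Mg(1) by (auto simp: q_def C_def)
  ultimately have qB: "bounded_borel_by C q"
    by (simp add: bounded_borel_by_def)
  have sum: "(SUP z\<in>{z. norm z = 1}. Iop p \<epsilon> z q x) + (INF z\<in>{z. norm z = 1}. Iop p \<epsilon> z q x)
      \<le> 2 * (q x - \<epsilon>\<^sup>2 * Mf)" if x: "x \<in> \<Omega>" for x
  proof -
    let ?I = "INF z\<in>{z. norm z = 1}. Iop p \<epsilon> z q x"
    have qx: "q x = C - A * (norm x)\<^sup>2"
      using x subset_nbhd[OF \<epsilon>] by (auto simp: q_def)
    \<comment> \<open>The average along \<open>z\<close> is the constant total minus the one along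
      \<open>- z\<close>, which is at least the infimum. This bound is uniform in
      \<open>z\<close>.\<close>
    have "(SUP z\<in>{z. norm z = 1}. Iop p \<epsilon> z q x) \<le> 2 * (q x - \<epsilon>\<^sup>2 * Mf) - ?I"
    proof (rule cSUP_least[OF unit_sphere_nonempty])
      fix z :: "real ^ 'n" assume "z \<in> {z. norm z = 1}"
      then have z: "norm z = 1" by simp
      have "Iop p \<epsilon> z q x + Iop p \<epsilon> (- z) q x =
          2 * (C - A * (norm x)\<^sup>2) - 2 * A * \<epsilon>\<^sup>2 * (moment 2 p z / moment 0 p z)"
        by (rule Iop_quadratic[OF p z qB]) (simp add: q_def nbhd_shift[OF \<epsilon> x])
      also have "\<dots> = 2 * (q x - \<epsilon>\<^sup>2 * Mf)"
        unfolding \<kappa>[OF z] qx A(2)[symmetric] by (simp add: algebra_simps)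
      finally have "Iop p \<epsilon> z q x + Iop p \<epsilon> (- z) q x = 2 * (q x - \<epsilon>\<^sup>2 * Mf)" .
      moreover have "?I \<le> Iop p \<epsilon> (- z) q x"
        using z by (intro cINF_lower Iop_bdd[OF p qB]) simp
      ultimately show "Iop p \<epsilon> z q x \<le> 2 * (q x - \<epsilon>\<^sup>2 * Mf) - ?I" by linarith
    qed
    then show ?thesis by linarith
  qed
  have ef: "\<epsilon>\<^sup>2 * f x \<le> \<epsilon>\<^sup>2 * Mf" "- (\<epsilon>\<^sup>2 * Mf) \<le> \<epsilon>\<^sup>2 * f x" if "x \<in> \<Omega>" for x
    using mult_left_mono[of "f x" Mf "\<epsilon>\<^sup>2"] mult_left_mono[of "- Mf" "f x" "\<epsilon>\<^sup>2"] Mf(2)[OF that]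
    by (auto simp: abs_le_iff)
  have gq: "g x \<le> q x" "- q x \<le> g x" if "x \<in> Gam \<epsilon> \<Omega>" for x
    using Mg(2)[OF that] q_ge[of x] that by (auto simp: Gam_def)
  have "tug_step p \<epsilon> \<Omega> f g q x \<le> q x" for x
  proof (cases "x \<in> \<Omega>")
    case True
    then show ?thesis
      using sum[OF True] ef(1)[OF True] unfolding tug_step_def by (simp only: if_True) argo
  qed (use gq(1)[of x] q0[of x] in \<open>simp add: tug_step_def\<close>)
  \<comment> \<open>For \<open>- q\<close> the supremum and the infimum exchange roles with a change
    of sign, so \<open>sum\<close> applies again.\<close>
  moreover have "- q x \<le> tug_step p \<epsilon> \<Omega> f g (\<lambda>y. - q y) x" for x
  proof (cases "x \<in> \<Omega>")
    case True
    then show ?thesis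
      using sum[OF True] ef(2)[OF True] unfolding tug_step_def
      by (simp only: if_True INF_Iop_eq minus_minus) argo
  qed (use gq(2)[of x] q0[of x] in \<open>simp add: tug_step_def\<close>)
  ultimately show thesis
    using qB q0 that by blast
qed

section \<open>Monotone iteration and the fixed point\<close>

lemma bounded_borel_by_sandwich:
  assumes "bounded_borel_by B q" "u \<in> borel_measurable borel" "\<And>x. - q x \<le> u x" "\<And>x. u x \<le> q x"
  shows "bounded_borel_by B u"
proof -
  have "\<bar>u x\<bar> \<le> B" for x
    using assms(1,3,4) unfolding bounded_borel_by_def by (smt (verit))
  then show ?thesis using assms(2) by (simp add: bounded_borel_by_def)
qed

theorem theorem3p7:
  fixes p \<epsilon> :: real and \<Omega> :: "(real ^ 'n) set" and f g :: "real ^ 'n \<Rightarrow> real"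
  assumes "1 < p" and "0 < \<epsilon>"
    and "open \<Omega>" and "connected \<Omega>" and "bounded \<Omega>" and "\<Omega> \<noteq> {}"
    and "bounded_borel_on \<Omega> f" and "bounded_borel_on (Gam \<epsilon> \<Omega>) g"
  shows "\<exists>u :: real ^ 'n \<Rightarrow> real. bounded_borel_on (nbhd \<epsilon> \<Omega>) u \<and>
    (\<forall>x\<in>\<Omega>. u x = 1 / 2 * ((SUP z\<in>{z. norm z = 1}. Iop p \<epsilon> z u x)
                          + (INF z\<in>{z. norm z = 1}. Iop p \<epsilon> z u x)) + \<epsilon>\<^sup>2 * f x) \<and>
    (\<forall>x\<in>Gam \<epsilon> \<Omega>. u x = g x)"
proof -
  obtain B q where q: "bounded_borel_by B q" and q0: "\<And>x. 0 \<le> q x"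
    and super: "\<And>x. tug_step p \<epsilon> \<Omega> f g q x \<le> q x"
    and sub: "\<And>x. - q x \<le> tug_step p \<epsilon> \<Omega> f g (\<lambda>y. - q y) x"
    using ex_tug_barrier[OF assms(1-3,5-8)] by blast
  note mono = tug_step_mono[OF assms(1), of B]
  define T where "T = tug_step p \<epsilon> \<Omega> f g"
  define u where "u k = (T ^^ k) (\<lambda>y. - q y)" for k
  have u_Suc: "u (Suc k) = T (u k)" for k
    by (simp add: u_def)
  have minus_q: "bounded_borel_by B (\<lambda>y. - q y)"
    by (rule bounded_borel_by_uminus[OF q])
  \<comment> \<open>Proved jointly: \<open>T\<close> is monotone only between bounded Borel
    functions, while the bound on the next iterate comes from the two barriers.\<close>
  have inv: "bounded_borel_by B (u k) \<and> (\<forall>x. - q x \<le> u k x) \<and> (\<forall>x. u k x \<le> q x)" for k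
  proof (induction k)
    case 0
    then show ?case
      using minus_q q0 by (auto simp: u_def intro: order_trans[of _ 0])
  next
    case (Suc k)
    then have k: "bounded_borel_by B (u k)" "\<And>x. - q x \<le> u k x" "\<And>x. u k x \<le> q x" by auto
    have lower: "- q x \<le> u (Suc k) x" for x
      unfolding u_Suc T_def by (rule order_trans[OF sub mono[OF minus_q k(1,2)]])
    have upper: "u (Suc k) x \<le> q x" for x
      unfolding u_Suc T_def by (rule order_trans[OF mono[OF k(1) q k(3)] super])
    have "u (Suc k) \<in> borel_measurable borel"
      unfolding u_Suc T_def by (rule tug_step_measurable[OF assms(1) k(1) assms(3,7,8)])
    from bounded_borel_by_sandwich[OF q this lower upper] lower upper show ?case by blast
  qed
  then have uB: "bounded_borel_by B (u k)" and u_le: "u k x \<le> q x" and u_ge: "- q x \<le> u k x" for k x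
    by blast+
  \<comment> \<open>The first inequality says that \<open>- q\<close> is a subsolution; monotonicity
    of \<open>T\<close> propagates it.\<close>
  have "u k x \<le> u (Suc k) x" for k x
  proof (induction k arbitrary: x)
    case 0
    then show ?case using sub by (simp add: u_Suc T_def) (simp add: u_def)
  next
    case (Suc k)
    then show ?case
      using mono[OF uB uB Suc] by (simp add: u_Suc T_def)
  qed
  then have inc: "incseq (\<lambda>k. u k x)" for x
    by (simp add: incseq_Suc_iff)
  have "\<exists>l. (\<lambda>k. u k x) \<longlonglongrightarrow> l" for x
    using incseq_convergent[OF inc] u_le by blast
  then obtain v where v: "\<And>x. (\<lambda>k. u k x) \<longlonglongrightarrow> v x" by metis
  have vB: "bounded_borel_by B v"
  proof (rule bounded_borel_by_sandwich[OF q])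
    show "v \<in> borel_measurable borel"
      by (rule borel_measurable_LIMSEQ_real[OF v]) (use uB in \<open>auto simp: bounded_borel_by_def\<close>)
    show "- q x \<le> v x" "v x \<le> q x" for x
      using LIMSEQ_le_const[OF v] LIMSEQ_le_const2[OF v] u_ge u_le by blast+
  qed
  \<comment> \<open>The shifted sequence \<open>u (Suc k)\<close> has the limit \<open>v\<close> as
    a subsequence and the limit \<open>T v\<close> by continuity of \<open>T\<close> along bounded
    pointwise limits.\<close>
  have fixp: "v x = tug_step p \<epsilon> \<Omega> f g v x" for x
  proof (rule LIMSEQ_unique)
    show "(\<lambda>k. u (Suc k) x) \<longlonglongrightarrow> v x"
      using v by (rule LIMSEQ_Suc)
    show "(\<lambda>k. u (Suc k) x) \<longlonglongrightarrow> tug_step p \<epsilon> \<Omega> f g v x"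
      unfolding u_Suc T_def by (rule tug_step_tendsto[OF assms(1) uB vB v])
  qed
  show ?thesis
  proof (intro exI[of _ v] conjI ballI)
    show "bounded_borel_on (nbhd \<epsilon> \<Omega>) v"
      using vB by (auto simp: bounded_borel_on_def bounded_borel_by_def bounded_iff
          intro: measurable_restrict_space1)
    show "v x = 1 / 2 * ((SUP z\<in>{z. norm z = 1}. Iop p \<epsilon> z v x)
        + (INF z\<in>{z. norm z = 1}. Iop p \<epsilon> z v x)) + \<epsilon>\<^sup>2 * f x" if "x \<in> \<Omega>" for x
      using fixp[of x] that by (simp add: tug_step_def)
    show "v x = g x" if "x \<in> Gam \<epsilon> \<Omega>" for x
      using fixp[of x] that by (simp add: tug_step_def Gam_def)
  qed
qed

end
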